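(* Let $w=[x_1[x_2,x_3,x_4],x_5]\in\mathbb{Z}\langle X\rangle$ (the commutator of the product $x_1\cdot[x_2,x_3,x_4]$ with $x_5$). Then $w\in\gamma_3$, $6\,w\in\gamma_4$, but $w\notin\gamma_4$.
   Context: $\mathbb{Z}\langle X\rangle$ is the free unitary associative ring freely generated by the infinite countable set $X=\{x_1,x_2,\dots\}$. Commutators are left-normed: $[a,b]=ab-ba$, $[a,b,c]=[[a,b],c]$. Define $\gamma_n=\gamma_n(\mathbb{Z}\langle X\rangle)$ by $\gamma_1=\mathbb{Z}\langle X\rangle$ and $\gamma_{n+1}=[\gamma_n,\mathbb{Z}\langle X\rangle]$ for $n\ge 1$, where $[A,B]$ denotes the additive subgroup generated by all $[a,b]$ with $a\in A$, $b\in B$; that is, $\gamma_n$ is the $n$-th term of the lower central series of $\mathbb{Z}\langle X\rangle$ viewed as a Lie ring. *)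

theory Defs
  imports Main "HOL-Library.Poly_Mapping" "HOL-Computational_Algebra.Group_Closure"
begin

(* The free monoid on 'a, written additively because the convolution product on
   poly_mapping expects the exponents to form an additive (here noncommutative) monoid. *)
datatype 'a word = Word (letters: "'a list")

instantiation word :: (type) monoid_add
begin

definition zero_word :: "'a word" where
  "0 = Word []"

definition plus_word :: "'a word \<Rightarrow> 'a word \<Rightarrow> 'a word" where
  "u + v = Word (letters u @ letters v)"

instance
  by standard (simp_all add: zero_word_def plus_word_def)

end

(* The free unitary associative ring, realized as the monoid ring over the integers
   of the free monoid: finitely supported integer functions on words, with convolution.
   The alphabet is nat. *)
type_synonym free_ring = "nat word \<Rightarrow>\<^sub>0 int"

(* Indices are shifted by one: var i is the generator x_(i+1), so that X = range var. *)
definition var :: "nat \<Rightarrow> free_ring" where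
  "var i = Poly_Mapping.single (Word [i]) 1"

definition comm :: "'a::ring \<Rightarrow> 'a \<Rightarrow> 'a" where
  "comm a b = a * b - b * a"

definition comm_set :: "'a::ring set \<Rightarrow> 'a set \<Rightarrow> 'a set" where
  "comm_set A B = group_closure {comm a b | a b. a \<in> A \<and> b \<in> B}"

(* lcs n is gamma_n for n >= 1; the value at 0 is a dummy. *)
fun lcs :: "nat \<Rightarrow> 'a::ring_1 set" where
  "lcs 0 = UNIV"
| "lcs (Suc 0) = UNIV"
| "lcs (Suc (Suc n)) = comm_set (lcs (Suc n)) UNIV"

definition w :: free_ring where
  "w = comm (var 0 * comm (comm (var 1) (var 2)) (var 3)) (var 4)"

end

theory Submission
  imports Defs "HOL-Library.Multiset" "HOL-Number_Theory.Cong"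
begin

text \<open>
  Write \<open>W a b c d e = [a[b,c,d],e]\<close> (\<open>wcomm\<close> below), so that \<open>w\<close> is
  \<open>W\<close> at five generators, and \<open>\<gamma>\<^sub>n\<close> for the lower central series.
  Everything except the last claim holds in an arbitrary ring.

  \<^emph>\<open>Third term.\<close> The Leibniz rule gives \<open>[a[b,c,d],e] = [a[b,c],d,e] -
  [[a,d][b,c],e]\<close>, so it is enough to see that \<open>[[x,c][b,d],e]\<close> lies in
  \<open>\<gamma>\<^sub>3\<close> (\<open>comm_mult_comm_in_lcs_3\<close>). Modulo
  \<open>\<gamma>\<^sub>3\<close> the expression \<open>[e,[b,c]y]\<close> is alternating in
  \<open>e\<close>, \<open>b\<close>, \<open>c\<close> (\<open>comm_comm_mult_antisym\<close>). Expanding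
  \<open>[[e,x],bcd]\<close> as a derivation in \<open>bcd\<close> and using this symmetry, \<open>[e,
  [x,b]cd + [x,c]bd + [x,d]bc]\<close> is in \<open>\<gamma>\<^sub>3\<close>; the same expression with
  \<open>db\<close> for \<open>bd\<close> is a commutator of \<open>e\<close> with an element of
  \<open>\<gamma>\<^sub>2\<close>. The difference is \<open>[e,[x,c][b,d]]\<close>.

  \<^emph>\<open>Six times.\<close> Modulo \<open>\<gamma>\<^sub>4\<close> the element \<open>W a b c d
  e\<close> changes sign under all transpositions of \<open>{a, d, e}\<close> and under that of \<open>{b,
  c}\<close>; the swap of \<open>a\<close> and \<open>e\<close> and the alternation used above are both
  instances of \<open>comm_mult_exchange\<close>. After the sign of the arrangement is divided out,
  \<open>W\<close> is a function on the edges \<open>{b, c}\<close> of the complete graph on the five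
  letters, and the Jacobi identity says that its sum over each triangle vanishes. The four triangles inside
  four letters give \<open>2 W\<close> the same value on any two disjoint edges
  (\<open>wcomm_double_swap\<close>), hence on all edges, since any two edges of the complete graph on five
  letters are joined by a chain of consecutively disjoint ones. Any triangle now yields \<open>6 W =
  0\<close>.

  \<^emph>\<open>Not in the fourth term.\<close> The previous part leaves an obstruction only at the primes
  2 and 3; there is one at 3. What is needed is a linear functional modulo 3 on the multilinear words in the
  five letters that kills \<open>\<gamma>\<^sub>4\<close> but not \<open>w\<close>. Label the letters by the
  field with five elements. A functional modulo 3 killing \<open>\<gamma>\<^sub>4\<close> can be averaged
  over the group of affine maps \<open>x \<mapsto> l + x k\<close>, because its order 20 is prime to 3;
  weighting the average with the sign character (which is the Legendre symbol of \<open>k\<close>) preserves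
  the value on \<open>w\<close>, since \<open>2 W\<close> is alternating in all five letters modulo
  \<open>\<gamma>\<^sub>4\<close>. So one may look for a functional of this symmetry, given by six numbers,
  one for each word beginning with the letters 0, 1. The function \<open>affine_sign\<close> below is such a
  solution, and the symmetry reduces the verification on all commutators of four words to those whose first
  two letters are 0 and 1 (\<open>comm_weight_normal_form\<close>).
\<close>

section \<open>The lower central series\<close>

lemma lcs_zero [simp]: "0 \<in> lcs n"
  by (induction n rule: lcs.induct) (auto simp: comm_set_def)

lemma lcs_diff: "x \<in> lcs n \<Longrightarrow> y \<in> lcs n \<Longrightarrow> x - y \<in> lcs n"
  by (induction n rule: lcs.induct) (auto simp: comm_set_def intro: group_closure.diff)

lemma lcs_minus: "x \<in> lcs n \<Longrightarrow> - x \<in> lcs n"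
  using lcs_diff[of 0 n x] by simp

lemma lcs_add: "x \<in> lcs n \<Longrightarrow> y \<in> lcs n \<Longrightarrow> x + y \<in> lcs n"
  using lcs_diff[of x n "- y"] lcs_minus[of y n] by simp

lemma lcs_double: "x \<in> lcs n \<Longrightarrow> 2 * x \<in> lcs n"
  by (simp add: mult_2 lcs_add)

lemma comm_in_lcs_Suc:
  assumes "x \<in> lcs n"
  shows "comm x y \<in> lcs (Suc n)"
proof (cases n)
  case (Suc m)
  then show ?thesis
    using assms by (auto simp: comm_set_def intro!: group_closure.base)
qed simp

lemma comm_diff_left: "comm (x - y) z = comm x z - comm y (z :: 'a::ring)"
  by (simp add: comm_def algebra_simps)

lemma comm_diff_right: "comm x (y - z) = comm x y - comm x (z :: 'a::ring)"
  by (simp add: comm_def algebra_simps)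

lemma comm_zero [simp]: "comm 0 x = 0" "comm x 0 = (0 :: 'a::ring)"
  by (simp_all add: comm_def)

lemma comm_swap: "comm x y = - comm y (x :: 'a::ring)"
  by (simp add: comm_def)

lemma comm_in_lcs_Suc_right: "y \<in> lcs n \<Longrightarrow> comm x y \<in> lcs (Suc n)"
  by (subst comm_swap) (intro lcs_minus comm_in_lcs_Suc)

lemma lcs_Suc_subset: "lcs (Suc n) \<subseteq> (lcs n :: 'a::ring_1 set)"
proof (induction n rule: lcs.induct)
  case (3 n)
  show ?case
  proof
    fix x :: 'a
    assume "x \<in> lcs (Suc (Suc (Suc n)))"
    then have "x \<in> group_closure {comm a b |a b. a \<in> lcs (Suc (Suc n)) \<and> b \<in> UNIV}"
      by (simp add: comm_set_def)
    then show "x \<in> lcs (Suc (Suc n))"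
    proof induction
      case (base s)
      then show ?case
        using 3 comm_in_lcs_Suc[of _ "Suc n"] by (auto simp del: lcs.simps)
    next
      case (diff s t)
      then show ?case by (intro lcs_diff)
    qed
  qed
qed simp_all

lemma lcs_SucD: "x \<in> lcs (Suc n) \<Longrightarrow> x \<in> lcs n"
  using lcs_Suc_subset by blast

text \<open>
  The identity \<open>[ps,q] + [sq,p] + [qp,s] = 0\<close> moves a factor cyclically through a commutator. For
  \<open>s\<close> in \<open>\<gamma>\<^sub>n\<close> its last term is negligible and \<open>sq\<close> may be replaced by \<open>qs\<close>, so the two outer letters
  anticommute. It is used for \<open>n = 2\<close> and for \<open>n = 3\<close>.
\<close>

lemma comm_mult_exchange:
  assumes "s \<in> lcs n"
  shows "comm (a * s) e + comm (e * s) a \<in> lcs (Suc n)"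
proof -
  have "comm (a * s) e + comm (e * s) a = comm (comm e s) a + comm s (e * a)"
    by (simp add: comm_def algebra_simps)
  moreover have "comm (comm e s) a \<in> lcs (Suc n)"
    by (rule lcs_SucD[OF comm_in_lcs_Suc[OF comm_in_lcs_Suc_right[OF assms]]])
  ultimately show ?thesis
    using assms by (simp add: lcs_add comm_in_lcs_Suc)
qed

section \<open>Membership in the third term\<close>

lemma lcs_comm [simp]: "comm x y \<in> lcs 2"
  using comm_in_lcs_Suc[of x 1 y] by (simp add: numeral_2_eq_2)

lemma comm_comm_in_lcs [simp]: "comm (comm x y) z \<in> lcs 3"
  using comm_in_lcs_Suc[OF lcs_comm, of x y z] by (simp add: eval_nat_numeral)

lemma comm_in_lcs_3: "x \<in> lcs 2 \<Longrightarrow> comm y x \<in> lcs 3"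
  using comm_in_lcs_Suc_right[of x 2 y] by (simp add: eval_nat_numeral)

text \<open>
  Up to the inner commutator \<open>[by,c]\<close> the product \<open>[b,c]y\<close> equals \<open>b[c,y]\<close>, and there \<open>b\<close> can be
  exchanged with \<open>e\<close>.
\<close>

lemma comm_comm_mult_antisym:
  "comm e (comm b c * y) + comm b (comm e c * y) \<in> lcs 3"
proof -
  have "comm e (comm b c * y) + comm b (comm e c * y) =
      comm e (comm (b * y) c) + comm b (comm (e * y) c)
      - (comm (b * comm c y) e + comm (e * comm c y) b)"
    by (simp add: comm_def algebra_simps)
  moreover have "comm (b * comm c y) e + comm (e * comm c y) b \<in> lcs 3"
    using comm_mult_exchange[OF lcs_comm, of b c y e] by (simp add: eval_nat_numeral)
  ultimately show ?thesis
    by (simp add: lcs_add lcs_diff comm_in_lcs_3)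
qed

text \<open>
  Antisymmetry in \<open>e\<close>, \<open>b\<close> together with the obvious one in the two entries of the inner commutator
  gives invariance under cyclic shifts.
\<close>

lemma comm_comm_mult_rotate:
  "comm b (comm e x * y) - comm e (comm x b * y) \<in> lcs 3"
  using comm_comm_mult_antisym[of e b x y]
  by (simp add: comm_def algebra_simps)

lemma comm_mult_comm_in_lcs_3: "comm (comm x c * comm b d) e \<in> lcs 3"
proof -
  let ?v = "comm e x"
  \<comment> \<open>This is \<open>[bcd,v]\<close> expanded by the cyclic identity, each product then being rotated until \<open>v\<close>
    comes first; a rotation changes it by a commutator, which \<open>[b,_]\<close> or \<open>[c,_]\<close> sends into \<open>\<gamma>\<^sub>3\<close>.\<close>
  have 1: "comm b (?v * (c * d)) + comm c (?v * (b * d)) + comm d (?v * (b * c)) \<in> lcs 3"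
  proof -
    have "comm b (?v * (c * d)) + comm c (?v * (b * d)) + comm d (?v * (b * c)) =
        comm b (comm ?v (c * d)) + comm c (comm (?v * b) d) - comm ?v (b * c * d)"
      by (simp add: comm_def algebra_simps)
    then show ?thesis
      by (simp add: lcs_add lcs_diff comm_in_lcs_3)
  qed
  \<comment> \<open>The second argument is a sum of commutators, as its six words cancel up to cyclic rotation.\<close>
  have 2: "comm e (comm x b * (c * d) + comm x c * (d * b) + comm x d * (b * c)) \<in> lcs 3"
  proof -
    have "comm x b * (c * d) + comm x c * (d * b) + comm x d * (b * c) =
        comm (x * b * c) d + comm (x * c * d) b + comm (x * d * b) c"
      by (simp add: comm_def algebra_simps)
    then show ?thesis
      by (simp add: lcs_add comm_in_lcs_3)
  qed
  \<comment> \<open>In the second argument of \<open>2\<close> the middle term has \<open>db\<close> where \<open>1\<close> has \<open>bd\<close>; the rest cancels.\<close>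
  have eq: "comm (comm x c * comm b d) e =
      (comm b (?v * (c * d)) - comm e (comm x b * (c * d)))
      + (comm c (?v * (b * d)) - comm e (comm x c * (b * d)))
      + (comm d (?v * (b * c)) - comm e (comm x d * (b * c)))
      + comm e (comm x b * (c * d) + comm x c * (d * b) + comm x d * (b * c))
      - (comm b (?v * (c * d)) + comm c (?v * (b * d)) + comm d (?v * (b * c)))"
    by (simp add: comm_def algebra_simps)
  show ?thesis
    unfolding eq by (rule 1 2 comm_comm_mult_rotate lcs_add lcs_diff)+
qed

definition wcomm :: "'a::ring_1 \<Rightarrow> 'a \<Rightarrow> 'a \<Rightarrow> 'a \<Rightarrow> 'a \<Rightarrow> 'a" where
  "wcomm a b c d e = comm (a * comm (comm b c) d) e"

lemma wcomm_in_lcs_3: "wcomm a b c d e \<in> lcs 3"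
proof -
  have "wcomm a b c d e =
      comm (comm (a * comm b c) d) e - comm (comm a d * comm b c) e"
    by (simp add: wcomm_def comm_def algebra_simps)
  then show ?thesis
    by (simp add: lcs_diff comm_mult_comm_in_lcs_3)
qed

section \<open>Six times the element lies in the fourth term\<close>

lemma wcomm_swap_bc: "wcomm a c b d e = - wcomm a b c d e"
  by (simp add: wcomm_def comm_def algebra_simps)

lemma wcomm_jacobi: "wcomm a b c d e + wcomm a c d b e + wcomm a d b c e = 0"
  by (simp add: wcomm_def comm_def algebra_simps)

lemma wcomm_swap_ae: "wcomm a b c d e + wcomm e b c d a \<in> lcs 4"
  using comm_mult_exchange[of "comm (comm b c) d" 3 a e]
  by (simp add: wcomm_def flip: eval_nat_numeral)

text \<open>
  For \<open>v = [b,c]\<close> the Leibniz rule turns \<open>a[v,d] + d[v,a]\<close> into \<open>[v,da] - [v,d,a]\<close>, and both summands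
  lie in \<open>\<gamma>\<^sub>3\<close>.
\<close>

lemma wcomm_swap_ad: "wcomm a b c d e + wcomm d b c a e \<in> lcs 4"
proof -
  let ?v = "comm b c"
  have "wcomm a b c d e + wcomm d b c a e =
      comm (comm ?v (d * a)) e - comm (comm (comm ?v d) a) e"
    by (simp add: wcomm_def comm_def algebra_simps)
  moreover have "comm (comm ?v (d * a)) e \<in> lcs 4"
    using comm_in_lcs_Suc[of "comm ?v (d * a)" 3 e] by simp
  moreover have "comm (comm ?v d) a \<in> lcs 3"
    by (rule lcs_SucD[OF comm_in_lcs_Suc]) simp
  then have "comm (comm (comm ?v d) a) e \<in> lcs 4"
    using comm_in_lcs_Suc[of "comm (comm ?v d) a" 3 e] by simp
  ultimately show ?thesis
    by (simp add: lcs_diff)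
qed

lemma wcomm_swap_de: "wcomm a b c d e + wcomm a b c e d \<in> lcs 4"
proof -
  have eq: "wcomm a b c d e + wcomm a b c e d =
      (wcomm a b c d e + wcomm d b c a e) - (wcomm d b c a e + wcomm e b c a d)
      + (wcomm e b c a d + wcomm a b c e d)"
    by simp
  show ?thesis
    unfolding eq by (rule wcomm_swap_ad wcomm_swap_ae lcs_add lcs_diff)+
qed

text \<open>
  The edges \<open>{b, c}\<close> and \<open>{a, d}\<close> are disjoint. Of the four triangles on \<open>a\<close>, \<open>b\<close>, \<open>c\<close>, \<open>d\<close>, two contain
  the first edge and the other two the second one, while each of the four remaining edges lies in one
  triangle of either kind. The difference of the corresponding Jacobi identities therefore leaves only
  the two edges, each of them twice. The identity in the proof records the sign changes that bring all
  terms into a common form.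
\<close>

lemma wcomm_double_swap:
  "2 * wcomm a b c d e - 2 * wcomm c d a b e \<in> lcs 4"
proof -
  have eq: "2 * wcomm a b c d e - 2 * wcomm c d a b e =
      (wcomm a b c d e + wcomm d b c a e)
      - (wcomm a c d b e + wcomm b c d a e)
      - (wcomm a d b c e + wcomm c d b a e)
      - (wcomm b d a c e + wcomm c d a b e)
      + (wcomm d c a b e + wcomm b c a d e)
      + (wcomm d a b c e + wcomm c a b d e)"
    by (simp add: wcomm_def comm_def algebra_simps mult_2)
  show ?thesis
    unfolding eq by (rule wcomm_swap_ad lcs_add lcs_diff)+
qed

text \<open>
  The edges \<open>{b, c}\<close> and \<open>{c, d}\<close> share a letter, but both are disjoint from \<open>{a, e}\<close>.
\<close>

lemma wcomm_double_rotate: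
  "2 * wcomm a b c d e - 2 * wcomm a c d b e \<in> lcs 4"
proof -
  have eq: "2 * wcomm a b c d e - 2 * wcomm a c d b e =
      2 * (wcomm a b c d e + wcomm a b c e d)
      - (2 * wcomm a b c e d - 2 * wcomm c e a b d)
      - 2 * (wcomm c e a b d + wcomm c e a d b)
      + (2 * wcomm c e a d b - 2 * wcomm a d c e b)
      + 2 * (wcomm a d c e b + wcomm a d c b e)"
    by (simp add: wcomm_swap_bc[of a d c b e] algebra_simps)
  show ?thesis
    unfolding eq by (rule wcomm_double_swap wcomm_swap_de lcs_double lcs_add lcs_diff)+
qed

text \<open>
  The three terms of the Jacobi identity on \<open>b\<close>, \<open>c\<close>, \<open>d\<close> have the same double, so the double of their
  vanishing sum is \<open>6 W\<close>.
\<close>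

lemma six_wcomm_in_lcs_4: "6 * wcomm a b c d e \<in> lcs 4"
proof -
  have "6 * wcomm a b c d e = 2 * wcomm a b c d e + 2 * wcomm a b c d e + 2 * wcomm a b c d e"
    by (simp flip: distrib_right)
  also have "\<dots> =
      2 * (wcomm a b c d e + wcomm a c d b e + wcomm a d b c e)
      + (2 * wcomm a b c d e - 2 * wcomm a c d b e)
      + (2 * wcomm a b c d e - 2 * wcomm a c d b e)
      + (2 * wcomm a c d b e - 2 * wcomm a d b c e)"
    by (simp add: algebra_simps)
  also have "\<dots> \<in> lcs 4"
    unfolding wcomm_jacobi mult_zero_right
    by (rule wcomm_double_rotate lcs_zero lcs_add)+
  finally show ?thesis .
qed

section \<open>A functional modulo three\<close>

text \<open>
  A word in all five residues contributes exactly if it has the shape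
  \<open>a, a + s, a - s, a + t, a - t\<close> modulo 5. Then \<open>t = \<plusminus> 2 s\<close>, so \<open>s t\<close> is 2 or 3, and this decides the
  sign. The remaining residues of \<open>s t\<close> occur only for words with a repeated letter; the value 0 for
  them makes the transformation rule under affine maps hold without exception.
\<close>

definition affine_sign :: "int list \<Rightarrow> int" where
  "affine_sign u =
    (if 5 dvd u ! 1 + u ! 2 - 2 * u ! 0
     then let r = (u ! 1 - u ! 0) * (u ! 3 - u ! 0) mod 5 in
       if r = 2 then 1 else if r = 3 then - 1 else 0
     else 0)"

definition weight :: "nat list \<Rightarrow> int" where
  "weight u = (if mset u = mset [0..<5] then affine_sign (map int u) else 0)"

text \<open>
  This is the value at the commutator \<open>[a,b,c,d]\<close> of the linear extension of \<open>h\<close> from words to the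
  free ring.
\<close>

definition comm_weight :: "('a list \<Rightarrow> int) \<Rightarrow> 'a list \<Rightarrow> 'a list \<Rightarrow> 'a list \<Rightarrow> 'a list \<Rightarrow> int" where
  "comm_weight h a b c d =
     (h (a @ b @ c @ d) - h (b @ a @ c @ d) - h (c @ a @ b @ d) + h (c @ b @ a @ d))
     - (h (d @ a @ b @ c) - h (d @ b @ a @ c) - h (d @ c @ a @ b) + h (d @ c @ b @ a))"

text \<open>
  An affine map with linear part \<open>k\<close> preserves the condition \<open>b + c = 2 a\<close> and multiplies the product
  of the differences by \<open>k\<^sup>2\<close>, which is 1 or -1 modulo 5; multiplication by -1 exchanges 2 and 3.
\<close>

lemma affine_sign_affine:
  assumes k: "\<not> 5 dvd k" and u: "length u = 5"
  shows "affine_sign (map (\<lambda>x. (l + x * k) mod 5) u) =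
    (if k * k mod 5 = 1 then 1 else - 1) * affine_sign u"
proof -
  define a b c d where "a = u ! 0" "b = u ! 1" "c = u ! 2" "d = u ! 3"
  let ?g = "\<lambda>x. (l + x * k) mod 5"
  have g: "[?g x = l + x * k] (mod 5)" for x
    by simp
  have "[?g b + ?g c - 2 * ?g a = (l + b * k) + (l + c * k) - 2 * (l + a * k)] (mod 5)"
    by (intro cong_add cong_diff cong_mult cong_refl g)
  also have "(l + b * k) + (l + c * k) - 2 * (l + a * k) = (b + c - 2 * a) * k"
    by (simp add: algebra_simps)
  finally have "[?g b + ?g c - 2 * ?g a = (b + c - 2 * a) * k] (mod 5)" .
  then have "5 dvd ?g b + ?g c - 2 * ?g a \<longleftrightarrow> 5 dvd (b + c - 2 * a) * k"
    by (rule cong_dvd_iff)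
  also have "\<dots> \<longleftrightarrow> 5 dvd b + c - 2 * a"
    using k by (simp add: prime_dvd_mult_iff)
  finally have line: "5 dvd ?g b + ?g c - 2 * ?g a \<longleftrightarrow> 5 dvd b + c - 2 * a" .
  have "[(?g b - ?g a) * (?g d - ?g a) =
      ((l + b * k) - (l + a * k)) * ((l + d * k) - (l + a * k))] (mod 5)"
    by (intro cong_diff cong_mult g)
  also have "((l + b * k) - (l + a * k)) * ((l + d * k) - (l + a * k)) =
      (b - a) * (d - a) * (k * k)"
    by (simp add: algebra_simps)
  also have "[\<dots> = ((b - a) * (d - a) mod 5) * (k * k mod 5)] (mod 5)"
    by (intro cong_mult) (simp_all add: cong_def)
  finally have prd: "(?g b - ?g a) * (?g d - ?g a) mod 5 =
      ((b - a) * (d - a) mod 5) * (k * k mod 5) mod 5"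
    unfolding cong_def .
  have "k mod 5 \<in> {1, 2, 3, 4}"
    using k by (auto simp: dvd_eq_mod_eq_0)
  then have kk: "k * k mod 5 \<in> {1, 4}"
    by (auto simp: mod_mult_eq[of k 5 k, symmetric])
  have res: "(if r * \<kappa> mod 5 = 2 then 1 else if r * \<kappa> mod 5 = 3 then - 1 else 0) =
      (if \<kappa> = 1 then 1 else - 1) * (if r = 2 then 1 else if r = 3 then - 1 else (0 :: int))"
    if "r \<in> {0, 1, 2, 3, 4}" "\<kappa> \<in> {1, 4}" for r \<kappa> :: int
    using that by auto
  have "(b - a) * (d - a) mod 5 \<in> {0, 1, 2, 3, 4}"
    by auto
  note res = res[OF this kk]
  have "affine_sign (map ?g u) =
      (if 5 dvd ?g b + ?g c - 2 * ?g a
       then let r = (?g b - ?g a) * (?g d - ?g a) mod 5 in if r = 2 then 1 else if r = 3 then - 1 else 0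
       else 0)"
    by (simp add: affine_sign_def a_b_c_d_def u)
  also have "\<dots> = (if 5 dvd b + c - 2 * a
      then (if k * k mod 5 = 1 then 1 else - 1) *
        (let r = (b - a) * (d - a) mod 5 in if r = 2 then 1 else if r = 3 then - 1 else 0)
      else 0)"
    unfolding line prd Let_def res ..
  also have "\<dots> = (if k * k mod 5 = 1 then 1 else - 1) * affine_sign u"
    by (cases "5 dvd u ! 1 + u ! 2 - 2 * u ! 0")
      (simp_all only: affine_sign_def a_b_c_d_def if_True if_False mult_zero_right)
  finally show ?thesis .
qed

lemma comm_weight_normal_form:
  fixes r s t :: int
  assumes "r \<in> {2, 3, 4}" "s \<in> {2, 3, 4}" "t \<in> {2, 3, 4}" "distinct [r, s, t]"
  shows "3 dvd comm_weight affine_sign [0, 1] [r] [s] [t]"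
    and "3 dvd comm_weight affine_sign [0] [1, r] [s] [t]"
    and "3 dvd comm_weight affine_sign [0] [1] [r, s] [t]"
    and "3 dvd comm_weight affine_sign [0] [1] [r] [s, t]"
proof -
  consider "r = 2" "s = 3" "t = 4" | "r = 2" "s = 4" "t = 3" | "r = 3" "s = 2" "t = 4"
    | "r = 3" "s = 4" "t = 2" | "r = 4" "s = 2" "t = 3" | "r = 4" "s = 3" "t = 2"
    using assms by auto
  note cases = this
  show "3 dvd comm_weight affine_sign [0, 1] [r] [s] [t]"
    by (cases rule: cases) (simp_all add: comm_weight_def affine_sign_def)
  show "3 dvd comm_weight affine_sign [0] [1, r] [s] [t]"
    by (cases rule: cases) (simp_all add: comm_weight_def affine_sign_def)
  show "3 dvd comm_weight affine_sign [0] [1] [r, s] [t]"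
    by (cases rule: cases) (simp_all add: comm_weight_def affine_sign_def)
  show "3 dvd comm_weight affine_sign [0] [1] [r] [s, t]"
    by (cases rule: cases) (simp_all add: comm_weight_def affine_sign_def)
qed

lemma comm_weight_affine:
  fixes l k :: int
  assumes "\<not> 5 dvd k" "length a + length b + length c + length d = 5"
    and "3 dvd comm_weight affine_sign a b c d"
  defines "g \<equiv> \<lambda>x. (l + x * k) mod 5"
  shows "3 dvd comm_weight affine_sign (map g a) (map g b) (map g c) (map g d)"
proof -
  have "comm_weight affine_sign (map g a) (map g b) (map g c) (map g d) =
      (if k * k mod 5 = 1 then 1 else - 1) * comm_weight affine_sign a b c d"
    using assms(1,2)
    by (simp add: comm_weight_def g_def affine_sign_affine flip: map_append)
  then show ?thesis
    using assms(3) by (simp del: mult_minus_left)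
qed

lemma not_5_dvd_diff:
  fixes p q :: int
  assumes "{p, q} \<subseteq> {0..<5}" "p \<noteq> q"
  shows "\<not> 5 dvd q - p"
  using assms by (auto simp flip: mod_eq_dvd_iff)

text \<open>
  The affine map with \<open>0 \<mapsto> p\<close> and \<open>1 \<mapsto> q\<close> is onto the residues; its inverse is explicit because
  \<open>(q - p)\<^sup>3\<close> inverts \<open>q - p\<close> modulo 5.
\<close>

lemma affine_coordinate:
  fixes p q x :: int
  assumes "{p, q, x} \<subseteq> {0..<5}" "p \<noteq> q"
  obtains y where "y \<in> {0..<5}" "(p + y * (q - p)) mod 5 = x"
proof
  let ?y = "(x - p) * (q - p) ^ 3 mod 5"
  show "?y \<in> {0..<5}" by simp
  have "(q - p) mod 5 \<in> {1, 2, 3, 4}"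
    using not_5_dvd_diff[of p q] assms by (auto simp: dvd_eq_mod_eq_0)
  then have fermat: "(q - p) ^ 4 mod 5 = 1"
    by (auto simp: power_mod[of "q - p" 5 4, symmetric])
  have "[p + ?y * (q - p) = p + (x - p) * (q - p) ^ 3 * (q - p)] (mod 5)"
    by (intro cong_add cong_mult cong_refl) simp
  also have "p + (x - p) * (q - p) ^ 3 * (q - p) = p + (x - p) * (q - p) ^ 4"
    by (simp add: eval_nat_numeral)
  also have "[\<dots> = p + (x - p) * 1] (mod 5)"
    by (intro cong_add cong_mult cong_refl) (simp add: cong_def fermat)
  finally show "(p + ?y * (q - p)) mod 5 = x"
    using assms by (simp add: cong_def)
qed

text \<open>
  A commutator of four nonempty words with five letters altogether has one word of length two and
  three of length one. An affine change of letters makes the first two letters 0 and 1.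
\<close>

lemma comm_weight_affine_sign:
  fixes p q r s t :: int
  assumes dist: "distinct [p, q, r, s, t]" and sub: "{p, q, r, s, t} \<subseteq> {0..<5}"
  shows "3 dvd comm_weight affine_sign [p, q] [r] [s] [t]"
    and "3 dvd comm_weight affine_sign [p] [q, r] [s] [t]"
    and "3 dvd comm_weight affine_sign [p] [q] [r, s] [t]"
    and "3 dvd comm_weight affine_sign [p] [q] [r] [s, t]"
proof -
  let ?g = "\<lambda>x. (p + x * (q - p)) mod 5"
  have k: "\<not> 5 dvd q - p"
    using not_5_dvd_diff[of p q] sub dist by simp
  obtain r' where r': "r' \<in> {0..<5}" "?g r' = r"
    using affine_coordinate[of p q r] sub dist by auto
  obtain s' where s': "s' \<in> {0..<5}" "?g s' = s"
    using affine_coordinate[of p q s] sub dist by auto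
  obtain t' where t': "t' \<in> {0..<5}" "?g t' = t"
    using affine_coordinate[of p q t] sub dist by auto
  have g01: "?g 0 = p" "?g 1 = q"
    using sub by auto
  have "distinct (map ?g [0, 1, r', s', t'])"
    using dist by (simp only: list.map g01 r' s' t')
  then have dist': "distinct [0, 1, r', s', t']"
    unfolding distinct_map by (rule conjunct1)
  have "x \<in> {2, 3, 4}" if "x \<in> {0..<5}" "x \<noteq> 0" "x \<noteq> 1" for x :: int
    using that by auto
  then have "r' \<in> {2, 3, 4}" "s' \<in> {2, 3, 4}" "t' \<in> {2, 3, 4}" "distinct [r', s', t']"
    using dist' r'(1) s'(1) t'(1) by simp_all
  note normal = comm_weight_normal_form[OF this]
  note transfer = comm_weight_affine[OF k, where l = p]
  show "3 dvd comm_weight affine_sign [p, q] [r] [s] [t]"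
    using transfer[OF _ normal(1)] by (simp add: g01[simplified] r' s' t')
  show "3 dvd comm_weight affine_sign [p] [q, r] [s] [t]"
    using transfer[OF _ normal(2)] by (simp add: g01[simplified] r' s' t')
  show "3 dvd comm_weight affine_sign [p] [q] [r, s] [t]"
    using transfer[OF _ normal(3)] by (simp add: g01[simplified] r' s' t')
  show "3 dvd comm_weight affine_sign [p] [q] [r] [s, t]"
    using transfer[OF _ normal(4)] by (simp add: g01[simplified] r' s' t')
qed

text \<open>
  All eight words of the expansion have the same letters, so only commutators multilinear in the five
  letters matter, and those with an empty word cancel.
\<close>

lemma three_dvd_comm_weight: "3 dvd comm_weight weight a b c d"
proof (cases "mset (a @ b @ c @ d) = mset [0..<5]")
  case False
  then show ?thesis
    by (simp add: comm_weight_def weight_def ac_simps)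
next
  case True
  have eq: "comm_weight weight a b c d =
      comm_weight affine_sign (map int a) (map int b) (map int c) (map int d)"
    using True by (simp add: comm_weight_def weight_def ac_simps)
  have len: "length a + length b + length c + length d = 5"
    using True[THEN mset_eq_length] by simp
  have "distinct (a @ b @ c @ d)"
    using True[THEN mset_eq_imp_distinct_iff] by simp
  then have dist: "distinct (map int (a @ b @ c @ d))"
    unfolding distinct_map by (simp add: inj_on_def)
  have sub: "set (map int (a @ b @ c @ d)) \<subseteq> {0..<5}"
    using True[THEN mset_eq_setD] by auto
  show ?thesis
  proof (cases "a = [] \<or> b = [] \<or> c = [] \<or> d = []")
    case True
    then show ?thesis
      by (auto simp: comm_weight_def)
  next
    case False
    then obtain p a' q b' r c' s d' where
      abcd: "a = p # a'" "b = q # b'" "c = r # c'" "d = s # d'"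
      by (auto simp: neq_Nil_conv)
    then have "length a' + length b' + length c' + length d' = 1"
      using len by simp
    then consider t where "a' = [t]" "b' = []" "c' = []" "d' = []"
      | t where "a' = []" "b' = [t]" "c' = []" "d' = []"
      | t where "a' = []" "b' = []" "c' = [t]" "d' = []"
      | t where "a' = []" "b' = []" "c' = []" "d' = [t]"
      by (auto simp: add_is_1 length_Suc_conv)
    then show ?thesis
      using dist sub unfolding eq unfolding abcd
      by cases (auto intro!: comm_weight_affine_sign)
  qed
qed

definition weight_functional :: "free_ring \<Rightarrow> int" where
  "weight_functional f =
    (\<Sum>u | weight (letters u) \<noteq> 0. Poly_Mapping.lookup f u * weight (letters u))"

lemma finite_weight_support: "finite {u. weight (letters u) \<noteq> 0}"
proof (rule finite_subset)
  show "{u. weight (letters u) \<noteq> 0} \<subseteq> Word ` {xs. set xs \<subseteq> {0..<5} \<and> length xs = 5}"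
  proof
    fix u
    assume "u \<in> {u. weight (letters u) \<noteq> 0}"
    then have "mset (letters u) = mset [0..<5]"
      by (simp add: weight_def split: if_splits)
    from mset_eq_setD[OF this] mset_eq_length[OF this]
    have "letters u \<in> {xs. set xs \<subseteq> {0..<5} \<and> length xs = 5}"
      by simp
    then show "u \<in> Word ` {xs. set xs \<subseteq> {0..<5} \<and> length xs = 5}"
      by (intro image_eqI[of u Word "letters u"]) simp_all
  qed
qed (simp add: finite_lists_length_eq)

lemma weight_functional_zero [simp]: "weight_functional 0 = 0"
  by (simp add: weight_functional_def)

lemma weight_functional_diff:
  "weight_functional (f - g) = weight_functional f - weight_functional g"
  by (simp add: weight_functional_def lookup_minus algebra_simps sum_subtractf)

lemma weight_functional_add:
  "weight_functional (f + g) = weight_functional f + weight_functional g"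
  by (simp add: weight_functional_def lookup_add algebra_simps sum.distrib)

lemma weight_functional_single [simp]:
  "weight_functional (Poly_Mapping.single u c) = c * weight (letters u)"
proof -
  have "weight_functional (Poly_Mapping.single u c) =
      (\<Sum>v | weight (letters v) \<noteq> 0. if u = v then c * weight (letters v) else 0)"
    unfolding weight_functional_def
    by (intro sum.cong) (simp_all add: lookup_single)
  also have "\<dots> = c * weight (letters u)"
    by (simp add: finite_weight_support)
  finally show ?thesis .
qed

lemma weight_functional_comm4_words:
  "weight_functional (comm (comm (comm (frag_of a) (frag_of b)) (frag_of c)) (frag_of d)) =
    comm_weight weight (letters a) (letters b) (letters c) (letters d)"
  by (simp add: comm_def algebra_simps mult_single weight_functional_diff weight_functional_add
      comm_weight_def plus_word_def)

text \<open>
  Words generate the free ring additively, so multilinearity extends the divisibility from words to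
  one argument after the other.
\<close>

lemma three_dvd_weight_functional_comm4:
  "3 dvd weight_functional (comm (comm (comm f g) h) k)"
proof -
  have 1: "3 dvd weight_functional (comm (comm (comm (frag_of a) (frag_of b)) (frag_of c)) k)"
    for a b c
    using subset_UNIV[of "Poly_Mapping.keys k"]
    by (induction k rule: frag_induction)
      (auto simp: weight_functional_comm4_words three_dvd_comm_weight
        comm_diff_right weight_functional_diff)
  have 2: "3 dvd weight_functional (comm (comm (comm (frag_of a) (frag_of b)) h) k)" for a b
    using subset_UNIV[of "Poly_Mapping.keys h"]
    by (induction h rule: frag_induction)
      (auto simp: 1 comm_diff_left comm_diff_right weight_functional_diff)
  have 3: "3 dvd weight_functional (comm (comm (comm (frag_of a) g) h) k)" for a
    using subset_UNIV[of "Poly_Mapping.keys g"]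
    by (induction g rule: frag_induction)
      (auto simp: 2 comm_diff_left comm_diff_right weight_functional_diff)
  show ?thesis
    using subset_UNIV[of "Poly_Mapping.keys f"]
    by (induction f rule: frag_induction)
      (auto simp: 3 comm_diff_left comm_diff_right weight_functional_diff)
qed

lemma lcs_Suc_induct [consumes 1, case_names zero comm diff]:
  assumes "x \<in> lcs (Suc n)" "0 < n"
    and "P 0"
    and "\<And>y z. y \<in> lcs n \<Longrightarrow> P (comm y z)"
    and "\<And>y z. P y \<Longrightarrow> P z \<Longrightarrow> P (y - z)"
  shows "P x"
proof -
  obtain m where n: "n = Suc m"
    using \<open>0 < n\<close> by (cases n) auto
  have "x \<in> group_closure {comm a b |a b. a \<in> lcs n \<and> b \<in> UNIV}"
    using assms(1) by (simp add: n comm_set_def)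
  then show ?thesis
    by induction (use assms(3-) in auto)
qed

lemma three_dvd_weight_functional_lcs_4:
  assumes "f \<in> lcs 4"
  shows "3 dvd weight_functional f"
proof -
  have 2: "3 dvd weight_functional (comm (comm x h) k)" if "x \<in> lcs 2" for x h k
  proof -
    have "x \<in> lcs (Suc 1)" using that by (simp add: numeral_2_eq_2)
    then show ?thesis
      by (induction rule: lcs_Suc_induct)
        (auto simp: comm_diff_left weight_functional_diff three_dvd_weight_functional_comm4)
  qed
  have 3: "3 dvd weight_functional (comm x k)" if "x \<in> lcs 3" for x k
  proof -
    have "x \<in> lcs (Suc 2)" using that by simp
    then show ?thesis
      by (induction rule: lcs_Suc_induct)
        (auto simp: comm_diff_left weight_functional_diff 2)
  qed
  have "f \<in> lcs (Suc 3)" using assms by simp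
  then show ?thesis
    by (induction rule: lcs_Suc_induct) (auto simp: weight_functional_diff 3)
qed

lemma w_eq_wcomm: "w = wcomm (var 0) (var 1) (var 2) (var 3) (var 4)"
  by (simp add: w_def wcomm_def)

lemma weight_functional_w: "\<not> 3 dvd weight_functional w"
proof -
  have "mset [0..<5] = {#0, 1, 2, 3, 4 :: nat#}"
    by (simp add: upt_rec eval_nat_numeral)
  then show ?thesis
    by (simp add: w_def var_def comm_def algebra_simps mult_single weight_functional_diff
        weight_functional_add plus_word_def weight_def affine_sign_def)
qed

theorem proposition1p5:
  shows "w \<in> lcs 3 \<and> 6 * w \<in> lcs 4 \<and> w \<notin> lcs 4"
  using wcomm_in_lcs_3 six_wcomm_in_lcs_4 weight_functional_w three_dvd_weight_functional_lcs_4
  by (auto simp: w_eq_wcomm)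

end
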